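(* Let $n\ge1$, $\delta>0$, $s\in\mathbb{R}$ and $f\in H^s(T^n)$. Let $u$ be the solution of the classical diffusion equation $u_t=\Delta u$ on $T^n$ with $u|_{t=0}=f$, and for any $\beta<n+4$ let $u^{\delta,\beta}$ be the solution of the nonlocal diffusion equation $u^{\delta,\beta}_t=L^{\delta,\beta}u^{\delta,\beta}$ on $T^n$, $t>0$, with $u^{\delta,\beta}(\cdot,0)=f$. Then for $t>0$, $$\lim_{\beta\to n+2}u^{\delta,\beta}(\cdot,t)=u(\cdot,t)\quad\text{in }H^\infty(T^n).$$
   Context: Let $r_1,\dots,r_n>0$ and let $T^n=\prod_{i=1}^n[0,r_i]$ be the periodic torus (opposite faces identified). For $k\in\mathbb{Z}^n$ put $\nu_k=\left(\frac{2\pi k_1}{r_1},\dots,\frac{2\pi k_n}{r_n}\right)$. A periodic distribution $h$ on $T^n$ is written through its Fourier coefficients as $h=\sum_{k\in\mathbb{Z}^n}\hat h_k e^{i\nu_k\cdot x}$. For $s\in\mathbb{R}$, $H^s(T^n)$ is the space of periodic distributions with $\|h\|_{H^s(T^n)}^2:=\sum_{k\in\mathbb{Z}^n}(1+\|k\|^2)^s|\hat h_k|^2<\infty$, and $H^\infty(T^n):=\bigcap_{s\in\mathbb{R}}H^s(T^n)$; convergence in $H^\infty(T^n)$ means convergence in $H^q(T^n)$ for every $q\in\mathbb{R}$. For $n\ge1$, $\delta>0$, $\beta<n+4$, the Fourier multiplier is $$m^{\delta,\beta}(\nu)=-\|\nu\|^2\;{}_2F_3\!\left(1,\tfrac{n+2-\beta}{2};\,2,\tfrac{n+2}{2},\tfrac{n+4-\beta}{2};\,-\tfrac14\|\nu\|^2\delta^2\right),\quad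 \nu\in\mathbb{R}^n.$$ For $\beta<n+2$ it equals $c^{\delta,\beta}\int_{B_\delta(0)}\frac{\cos(\nu\cdot z)-1}{\|z\|^\beta}dz$ with $c^{\delta,\beta}=\frac{2(n+2-\beta)\Gamma(\frac n2+1)}{\pi^{n/2}\delta^{n+2-\beta}}$; for $\beta=n+2$ it equals $-\|\nu\|^2$. The operator $L^{\delta,\beta}$ acts by $L^{\delta,\beta}J=\sum_{k}m^{\delta,\beta}(\nu_k)\hat J_k e^{i\nu_k\cdot x}$. The solutions have Fourier coefficients $\hat u^{\delta,\beta}_k(t)=\hat f_k e^{m^{\delta,\beta}(\nu_k)t}$ and $\hat u_k(t)=\hat f_k e^{-\|\nu_k\|^2t}$. The limit $\beta\to n+2$ is two-sided, with $\delta$ fixed. *)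

theory Defs
  imports "HOL-Analysis.Analysis"
begin

section \<open>Periodic distributions and Sobolev spaces\<close>

text \<open>
  The dimension is the cardinality of the finite index type \<open>'n\<close>. A periodic distribution is
  identified with its family of Fourier coefficients. The type below contains all families of
  complex numbers; membership in a Sobolev space \<open>H\<^sup>s\<close> forces the polynomial growth that
  characterises the coefficients of a distribution (lemma \<open>sobolev_space_growth\<close>).
\<close>

type_synonym 'n pdist = "int ^ 'n \<Rightarrow> complex"

definition freq :: "real ^ 'n \<Rightarrow> int ^ 'n \<Rightarrow> real ^ 'n" where
  "freq r k = (\<chi> i. 2 * pi * of_int (k $ i) / r $ i)"

definition knorm :: "int ^ 'n \<Rightarrow> real" where
  "knorm k = norm (\<chi> i. real_of_int (k $ i))"

definition sobolev_space :: "real \<Rightarrow> ('n::finite) pdist set" where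
  "sobolev_space s =
     {h. (\<lambda>k. (1 + (knorm k)\<^sup>2) powr s * (cmod (h k))\<^sup>2) summable_on UNIV}"

definition sobolev_norm :: "real \<Rightarrow> ('n::finite) pdist \<Rightarrow> real" where
  "sobolev_norm s h = sqrt (\<Sum>\<^sub>\<infinity>k. (1 + (knorm k)\<^sup>2) powr s * (cmod (h k))\<^sup>2)"

definition sobolev_inf :: "('n::finite) pdist set" where
  "sobolev_inf = (\<Inter>s. sobolev_space s)"

text \<open>
  Membership in the spaces has to be required explicitly, because \<open>infsum\<close>, and hence
  \<^const>\<open>sobolev_norm\<close>, is \<open>0\<close> for families that are not summable. Since the nets of interest are
  indexed by a parameter tending to a limit, membership is required eventually along the filter.
\<close>

definition tendsto_sobolev ::
  "real \<Rightarrow> ('b \<Rightarrow> ('n::finite) pdist) \<Rightarrow> 'n pdist \<Rightarrow> 'b filter \<Rightarrow> bool" where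
  "tendsto_sobolev q g h F \<longleftrightarrow>
     (\<forall>\<^sub>F x in F. g x \<in> sobolev_space q) \<and> h \<in> sobolev_space q \<and>
     ((\<lambda>x. sobolev_norm q (\<lambda>k. g x k - h k)) \<longlongrightarrow> 0) F"

definition tendsto_sobolev_inf ::
  "('b \<Rightarrow> ('n::finite) pdist) \<Rightarrow> 'n pdist \<Rightarrow> 'b filter \<Rightarrow> bool" where
  "tendsto_sobolev_inf g h F \<longleftrightarrow>
     (\<forall>\<^sub>F x in F. g x \<in> sobolev_inf) \<and> h \<in> sobolev_inf \<and>
     (\<forall>q. tendsto_sobolev q g h F)"

lemma sobolev_space_growth:
  fixes h :: "('n::finite) pdist"
  assumes "h \<in> sobolev_space s"
  shows "\<exists>C. \<forall>k. (cmod (h k))\<^sup>2 \<le> C * (1 + (knorm k)\<^sup>2) powr (- s)"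
proof -
  define w where "w = (\<lambda>k. (1 + (knorm k)\<^sup>2) powr s * (cmod (h k))\<^sup>2)"
  have w: "w summable_on UNIV"
    using assms by (simp add: sobolev_space_def w_def)
  have "(cmod (h k))\<^sup>2 \<le> infsum w UNIV * (1 + (knorm k)\<^sup>2) powr (- s)" for k
  proof -
    have pos: "1 + (knorm k)\<^sup>2 > 0"
      by (simp add: add_pos_nonneg)
    have "infsum w {k} \<le> infsum w UNIV"
      by (rule infsum_mono_neutral) (use w in \<open>auto simp: w_def\<close>)
    then have "w k \<le> infsum w UNIV"
      by simp
    then have "w k * (1 + (knorm k)\<^sup>2) powr (- s) \<le> infsum w UNIV * (1 + (knorm k)\<^sup>2) powr (- s)"
      by (rule mult_right_mono) simp
    moreover have "w k * (1 + (knorm k)\<^sup>2) powr (- s) = (cmod (h k))\<^sup>2"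
      using pos by (simp add: w_def powr_minus field_simps)
    ultimately show ?thesis by simp
  qed
  then show ?thesis by blast
qed


section \<open>The Laplacian and the nonlocal operator\<close>

text \<open>Differentiating \<open>exp (\<i> (\<nu>\<^sub>k \<bullet> x))\<close> in the direction \<open>j\<close> multiplies it by \<open>\<i> (\<nu>\<^sub>k)\<^sub>j\<close>.\<close>

definition pdist_deriv :: "real ^ 'n \<Rightarrow> 'n \<Rightarrow> ('n::finite) pdist \<Rightarrow> 'n pdist" where
  "pdist_deriv r j h = (\<lambda>k. \<i> * complex_of_real (freq r k $ j) * h k)"

definition laplacian :: "real ^ 'n \<Rightarrow> ('n::finite) pdist \<Rightarrow> 'n pdist" where
  "laplacian r h = (\<lambda>k. \<Sum>j\<in>UNIV. pdist_deriv r j (pdist_deriv r j h) k)"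

definition nonlocal_multiplier :: "real \<Rightarrow> real \<Rightarrow> real ^ ('n::finite) \<Rightarrow> real" where
  "nonlocal_multiplier \<delta> \<beta> \<nu> =
     - (norm \<nu>)\<^sup>2 *
     eval_fps (fps_hypergeo [1, (real CARD('n) + 2 - \<beta>) / 2]
                 [2, (real CARD('n) + 2) / 2, (real CARD('n) + 4 - \<beta>) / 2] 1)
       (- (1 / 4) * (norm \<nu>)\<^sup>2 * \<delta>\<^sup>2)"

definition nonlocal_op ::
  "real ^ 'n \<Rightarrow> real \<Rightarrow> real \<Rightarrow> ('n::finite) pdist \<Rightarrow> 'n pdist" where
  "nonlocal_op r \<delta> \<beta> J =
     (\<lambda>k. complex_of_real (nonlocal_multiplier \<delta> \<beta> (freq r k)) * J k)"

lemma laplacian_eq: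
  "laplacian r h k = complex_of_real (- (norm (freq r k))\<^sup>2) * h k"
proof -
  have ii: "\<i> * a * (\<i> * a * z) = - (a\<^sup>2) * z" for a z :: complex
  proof -
    have "\<i> * a * (\<i> * a * z) = (\<i> * \<i>) * a\<^sup>2 * z"
      unfolding power2_eq_square by (simp only: mult_ac)
    then show ?thesis by simp
  qed
  have "laplacian r h k = (\<Sum>j\<in>UNIV. - ((complex_of_real (freq r k $ j))\<^sup>2) * h k)"
    unfolding laplacian_def pdist_deriv_def ii ..
  also have "\<dots> = complex_of_real (- (\<Sum>j\<in>UNIV. (freq r k $ j)\<^sup>2)) * h k"
    by (simp add: sum_distrib_right sum_negf)
  also have "(\<Sum>j\<in>UNIV. (freq r k $ j)\<^sup>2) = (norm (freq r k))\<^sup>2"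
    by (simp add: norm_vec_def L2_set_def sum_nonneg)
  finally show ?thesis .
qed

lemma nonlocal_multiplier_series:
  fixes \<nu> :: "real ^ ('n::finite)"
  shows "nonlocal_multiplier \<delta> \<beta> \<nu> =
    - (norm \<nu>)\<^sup>2 * (\<Sum>j. pochhammer 1 j * pochhammer ((real CARD('n) + 2 - \<beta>) / 2) j /
        (pochhammer 2 j * pochhammer ((real CARD('n) + 2) / 2) j *
         pochhammer ((real CARD('n) + 4 - \<beta>) / 2) j * fact j) *
        (- (1 / 4) * (norm \<nu>)\<^sup>2 * \<delta>\<^sup>2) ^ j)"
  by (simp add: nonlocal_multiplier_def eval_fps_def)

lemma nonlocal_multiplier_critical:
  fixes \<nu> :: "real ^ ('n::finite)"
  shows "nonlocal_multiplier \<delta> (real CARD('n) + 2) \<nu> = - (norm \<nu>)\<^sup>2"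
proof -
  have "eval_fps (fps_hypergeo [1, 0] [2, a, b] 1) z = 1" for a b z :: real
  proof -
    have "fps_hypergeo [1, 0] [2, a, b] (1::real) = 1"
      by (rule fps_ext) (auto simp: pochhammer_0_left)
    then show ?thesis by simp
  qed
  then show ?thesis by (simp add: nonlocal_multiplier_def)
qed


section \<open>Solutions of evolution equations\<close>

text \<open>
  \<open>u\<close> solves \<open>u\<^sub>t = A u\<close> for \<open>t > 0\<close> with initial value \<open>f\<close>, where differentiability in time and
  continuity up to \<open>t = 0\<close> are understood coefficientwise. This is the weakest notion of a
  distribution-valued solution; for multiplier operators it still determines \<open>u t\<close> for all
  \<open>t \<ge> 0\<close> (lemma \<open>evolution_solution_multiplier\<close>).
\<close>

definition evolution_solution ::
  "(('n::finite) pdist \<Rightarrow> 'n pdist) \<Rightarrow> 'n pdist \<Rightarrow> (real \<Rightarrow> 'n pdist) \<Rightarrow> bool" where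
  "evolution_solution A f u \<longleftrightarrow>
     u 0 = f \<and>
     (\<forall>k. continuous_on {0..} (\<lambda>t. u t k)) \<and>
     (\<forall>t>0. \<forall>k. ((\<lambda>\<tau>. u \<tau> k) has_vector_derivative A (u t) k) (at t))"

lemma evolution_solution_multiplier:
  fixes f :: "('n::finite) pdist" and \<mu> :: "int ^ 'n \<Rightarrow> real"
  assumes A: "\<And>h k. A h k = complex_of_real (\<mu> k) * h k"
  shows "evolution_solution A f (\<lambda>t k. f k * exp (complex_of_real (\<mu> k * t)))"
    and "evolution_solution A f u \<Longrightarrow> t \<ge> 0 \<Longrightarrow> u t k = f k * exp (complex_of_real (\<mu> k * t))"
proof -
  have der: "((\<lambda>t. exp (complex_of_real (c * t))) has_vector_derivative
      complex_of_real c * exp (complex_of_real (c * t))) (at t within S)" for c t S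
    unfolding of_real_mult
    by (rule has_vector_derivative_eq_rhs, rule has_vector_derivative_real_field)
      (auto intro!: derivative_eq_intros simp: scaleR_conv_of_real)
  show "evolution_solution A f (\<lambda>t k. f k * exp (complex_of_real (\<mu> k * t)))"
    unfolding evolution_solution_def A
  proof (intro conjI allI impI)
    fix t :: real and k
    have "((\<lambda>\<tau>. f k * exp (complex_of_real (\<mu> k * \<tau>))) has_vector_derivative
        f k * (complex_of_real (\<mu> k) * exp (complex_of_real (\<mu> k * t)))) (at t)"
      by (rule has_vector_derivative_mult_right[OF der])
    then show "((\<lambda>\<tau>. f k * exp (complex_of_real (\<mu> k * \<tau>))) has_vector_derivative
        complex_of_real (\<mu> k) * (f k * exp (complex_of_real (\<mu> k * t)))) (at t)"
      by (simp only: mult.left_commute)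
  qed (auto intro!: continuous_intros)
  assume u: "evolution_solution A f u" and "t \<ge> 0"
  define w where "w = (\<lambda>\<tau>. u \<tau> k * exp (complex_of_real ((- \<mu> k) * \<tau>)))"
  have wc: "continuous_on {0..t} w"
    unfolding w_def using u
    by (intro continuous_intros)
      (auto simp: evolution_solution_def intro: continuous_on_subset[of "{0..}"])
  have wd: "(w has_derivative (\<lambda>h. 0)) (at x within {0..t})" if "x \<in> {0..t} - {0}" for x
  proof -
    have "((\<lambda>\<tau>. u \<tau> k) has_vector_derivative complex_of_real (\<mu> k) * u x k) (at x)"
      using u that by (auto simp: evolution_solution_def A)
    from has_vector_derivative_mult[OF this der[of "- \<mu> k"]]
    have "(w has_vector_derivative 0) (at x)"
      by (simp add: w_def algebra_simps)
    then show ?thesis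
      by (simp add: has_vector_derivative_def has_derivative_at_withinI)
  qed
  have "w t = w 0"
    using has_derivative_zero_unique_strong_interval[of "{0}" 0 t w "w 0" t] wc wd \<open>t \<ge> 0\<close>
    by auto
  then have "u t k * exp (complex_of_real ((- \<mu> k) * t)) = f k"
    using u by (simp add: w_def evolution_solution_def)
  then show "u t k = f k * exp (complex_of_real (\<mu> k * t))"
    by (auto simp: exp_minus field_simps)
qed

end

theory Submission
  imports Defs
begin

text \<open>
  Put \<open>a = (n + 2 - \<beta>) / 2\<close>, \<open>c = n / 2\<close> and \<open>x = \<parallel>\<nu>\<parallel>\<^sup>2 \<delta>\<^sup>2 / 4\<close>. The hypergeometric factor
  \<open>F(x) = 2F3(1, a; 2, c + 1, a + 1; -x)\<close> tends to \<open>1\<close> as \<open>a \<rightarrow> 0\<close>, because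
  \<open>\<bar>F(x) - 1\<bar> \<le> 2 \<bar>a\<bar> e\<^sup>x\<close>. By dominated convergence it is enough to bound \<open>F\<close> from below,
  uniformly for small \<open>\<bar>a\<bar>\<close>, so that the multiplier is at most \<open>C - \<kappa> \<parallel>k\<parallel>\<close>. With
  \<open>G(x) = 1F2(1; 2, c + 1; -x)\<close> one has \<open>(x\<^sup>a (F - b))' = a x\<^sup>a\<^sup>-\<^sup>1 (G - b)\<close> for \<open>b = 0, 1\<close>, and
  \<open>0 \<le> G \<le> 1\<close> follows from \<open>\<bar>0F1(; c; -x)\<bar> \<le> 1\<close>. Hence \<open>F \<ge> 1\<close> for \<open>a \<le> 0\<close>, and
  \<open>F(x) \<ge> F(1) x\<^sup>-\<^sup>a\<close> for \<open>a \<ge> 0\<close> and \<open>x \<ge> 1\<close>.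
\<close>

section \<open>Elementary bounds for power series and Pochhammer symbols\<close>

lemma summable_powser_fact_bound:
  fixes c :: "nat \<Rightarrow> real"
  assumes "\<And>n. \<bar>c n\<bar> \<le> C / fact n"
  shows "summable (\<lambda>n. c n * x ^ n)"
proof (rule summable_comparison_test'[where N = 0])
  show "summable (\<lambda>n. C * (inverse (fact n) * \<bar>x\<bar> ^ n))"
    by (intro summable_mult summable_exp)
  show "norm (c n * x ^ n) \<le> C * (inverse (fact n) * \<bar>x\<bar> ^ n)" for n
    using mult_right_mono[OF assms, of "\<bar>x\<bar> ^ n" n]
    by (simp add: abs_mult power_abs divide_inverse mult.assoc)
qed

lemma pochhammer_ge_1:
  fixes c :: real
  assumes "c \<ge> 1"
  shows "pochhammer c n \<ge> 1"
proof (induction n)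
  case (Suc n)
  have "1 * 1 \<le> pochhammer c n * (c + of_nat n)"
    using Suc assms by (intro mult_mono) auto
  then show ?case by (simp add: pochhammer_Suc)
qed simp

text \<open>Only the first factor can lie below 1. The case c < 1 is needed because c = n / 2 equals
  1 / 2 in dimension one.\<close>

lemma pochhammer_ge_min:
  fixes c :: real
  assumes "c > 0"
  shows "pochhammer c n \<ge> min 1 c"
proof (cases n)
  case (Suc m)
  have "c * 1 \<le> c * pochhammer (c + 1) m"
    using assms by (intro mult_left_mono pochhammer_ge_1) auto
  then show ?thesis by (simp add: Suc pochhammer_rec)
qed simp

section \<open>The series 0F1 and its bound\<close>

definition bessel_coeff :: "real \<Rightarrow> nat \<Rightarrow> real" where
  "bessel_coeff c n = (-1) ^ n / (fact n * pochhammer c n)"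

text \<open>For x > 0 this is Gamma(c) x^((1 - c) / 2) J_{c - 1}(2 sqrt x), with J the Bessel
  function.\<close>

definition bessel_series :: "real \<Rightarrow> real \<Rightarrow> real" where
  "bessel_series c x = (\<Sum>n. bessel_coeff c n * x ^ n)"

lemma summable_bessel:
  assumes "c > 0"
  shows "summable (\<lambda>n. bessel_coeff c n * x ^ n)"
proof (rule summable_powser_fact_bound)
  fix n
  have "min 1 c > 0" "pochhammer c n \<ge> min 1 c"
    using assms pochhammer_ge_min by auto
  then show "\<bar>bessel_coeff c n\<bar> \<le> (1 / min 1 c) / fact n"
    using assms by (auto simp: bessel_coeff_def abs_mult power_abs field_simps)
qed

lemma diffs_bessel_coeff:
  assumes "c > 0"
  shows "diffs (bessel_coeff c) n = - (1 / c) * bessel_coeff (c + 1) n"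
proof -
  have "pochhammer (c + 1) n > 0"
    using assms by (intro pochhammer_pos) auto
  then show ?thesis
    using assms by (simp add: diffs_def bessel_coeff_def pochhammer_rec divide_simps del: of_nat_Suc)
qed

lemma DERIV_bessel_series:
  assumes "c > 0"
  shows "(bessel_series c has_real_derivative - (1 / c) * bessel_series (c + 1) x) (at x)"
proof -
  have "((\<lambda>x. \<Sum>n. bessel_coeff c n * x ^ n) has_real_derivative
      (\<Sum>n. diffs (bessel_coeff c) n * x ^ n)) (at x)"
    by (intro termdiffs_strong_converges_everywhere summable_bessel assms)
  also have "(\<Sum>n. diffs (bessel_coeff c) n * x ^ n) = - (1 / c) * bessel_series (c + 1) x"
    unfolding bessel_series_def diffs_bessel_coeff[OF assms]
    using assms by (subst suminf_mult[symmetric]) (auto simp: mult.assoc intro!: summable_bessel)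
  finally show ?thesis
    by (simp add: bessel_series_def[abs_def])
qed

lemma bessel_series_0 [simp]: "bessel_series c 0 = 1"
  unfolding bessel_series_def powser_zero by (simp add: bessel_coeff_def)

text \<open>Since differentiation raises c by 1, this contiguous relation is the differential
  equation x y'' + c y' + y = 0 of y = \<open>bessel_series c\<close> in derivative-free
  form.\<close>

lemma bessel_series_recurrence:
  assumes "c > 0"
  shows "x * bessel_series (c + 2) x = c * (c + 1) * (bessel_series (c + 1) x - bessel_series c x)"
proof -
  have coeff: "bessel_coeff (c + 1) (Suc n) - bessel_coeff c (Suc n) =
      bessel_coeff (c + 2) n / (c * (c + 1))" for n
  proof -
    define P where "P = pochhammer (c + 2) n"
    have P: "P > 0"
      unfolding P_def using assms by (intro pochhammer_pos) auto
    have c: "c + real n + 1 > 0" "c > 0" "c + 1 > 0"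
      using assms by auto
    have 1: "pochhammer (c + 1) (Suc n) = (c + 1) * P"
      by (simp add: P_def pochhammer_rec add.assoc)
    have "pochhammer (c + 1) n * (c + 1 + real n) = (c + 1) * P"
      using 1 by (simp add: pochhammer_Suc)
    then have 2: "pochhammer c (Suc n) = c * ((c + 1) * P / (c + real n + 1))"
      using c by (simp add: pochhammer_rec field_simps)
    \<comment> \<open>Up to sign, \<open>q\<close> is the coefficient for c + 1; the one for c is
      larger by the factor (c + n + 1) / c. Their difference carries the factor n + 1 that reduces
      (n + 1)! to n!.\<close>
    define q where "q = (-1) ^ n / (fact (Suc n) * ((c + 1) * P))"
    have "bessel_coeff (c + 1) (Suc n) = - q"
      by (simp add: bessel_coeff_def 1 q_def)
    moreover have "bessel_coeff c (Suc n) = - (q * ((c + real n + 1) / c))"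
      unfolding bessel_coeff_def 2 q_def using P c by (simp add: divide_simps)
    moreover have "q * ((c + real n + 1) / c) - q = q * (real n + 1) / c"
      using c by (simp add: field_simps)
    moreover have "q * (real n + 1) / c = bessel_coeff (c + 2) n / (c * (c + 1))"
      using P c by (simp add: bessel_coeff_def q_def P_def[symmetric] divide_simps)
    ultimately show ?thesis by linarith
  qed
  have "(\<Sum>n. (bessel_coeff (c + 1) n - bessel_coeff c n) * x ^ n) =
      bessel_series (c + 1) x - bessel_series c x"
    unfolding bessel_series_def using assms
    by (subst suminf_diff) (auto simp: left_diff_distrib intro!: summable_bessel)
  moreover have "summable (\<lambda>n. (bessel_coeff (c + 1) n - bessel_coeff c n) * x ^ n)"
    unfolding left_diff_distrib using assms by (intro summable_diff summable_bessel) auto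
  \<comment> \<open>Both series start with 1, so the head of the difference vanishes and only the
    shifted tail remains.\<close>
  note powser_split_head(1)[OF this]
  moreover have "(\<Sum>n. (bessel_coeff (c + 1) (Suc n) - bessel_coeff c (Suc n)) * x ^ n) =
      bessel_series (c + 2) x / (c * (c + 1))"
    unfolding coeff bessel_series_def using assms
    by (subst suminf_divide[symmetric]) (auto intro!: summable_bessel)
  ultimately have "bessel_series (c + 1) x - bessel_series c x =
      bessel_series (c + 2) x / (c * (c + 1)) * x"
    by (simp add: bessel_coeff_def)
  moreover have "c * (c + 1) \<noteq> 0"
    using assms by auto
  ultimately show ?thesis
    by (simp only: times_divide_eq_left times_divide_eq_right nonzero_mult_div_cancel_left mult.commute simp_thms)
qed

text \<open>
  \<open>y = bessel_series c\<close> solves \<open>x y'' + c y' + y = 0\<close>, so that \<open>y\<^sup>2 + x y'\<^sup>2\<close> has the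
  derivative \<open>(1 - 2 c) y'\<^sup>2\<close>.
\<close>

lemma abs_bessel_series_le_1:
  assumes "c \<ge> 1 / 2" "x \<ge> 0"
  shows "\<bar>bessel_series c x\<bar> \<le> 1"
proof -
  have c: "c > 0" using assms by simp
  define E where "E x = (bessel_series c x)\<^sup>2 + x * (bessel_series (c + 1) x / c)\<^sup>2" for x
  have "\<exists>d. DERIV E z :> d \<and> d \<le> 0" for z
  proof -
    define y0 y1 y2 where "y0 = bessel_series c z" "y1 = bessel_series (c + 1) z"
      "y2 = bessel_series (c + 2) z"
    note y = y0_y1_y2_def
    have "DERIV (bessel_series (c + 1)) z :> - (1 / (c + 1)) * y2"
      using DERIV_bessel_series[of "c + 1" z] c by (simp add: y add.assoc)
    moreover have "DERIV (bessel_series c) z :> - (1 / c) * y1"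
      using DERIV_bessel_series[of c z] c by (simp add: y)
    ultimately have "DERIV E z :> 2 * y0 * (- (1 / c) * y1) +
        ((y1 / c)\<^sup>2 + z * (2 * (y1 / c) * (- (1 / (c + 1)) * y2 / c)))"
      unfolding E_def using c by (auto intro!: derivative_eq_intros simp: y mult_ac)
    also have "z * (2 * (y1 / c) * (- (1 / (c + 1)) * y2 / c)) =
        - (2 * y1 / (c * c * (c + 1))) * (z * y2)"
      using c by (simp add: field_simps)
    also have "z * y2 = c * (c + 1) * (y1 - y0)"
      unfolding y by (rule bessel_series_recurrence[OF c])
    also have "- (2 * y1 / (c * c * (c + 1))) * (c * (c + 1) * (y1 - y0)) = - (2 * y1 / c) * (y1 - y0)"
      using c by (simp add: divide_simps)
    also have "2 * y0 * (- (1 / c) * y1) + ((y1 / c)\<^sup>2 + - (2 * y1 / c) * (y1 - y0)) =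
        (1 - 2 * c) * (y1 / c)\<^sup>2"
      using c by (simp add: field_simps power2_eq_square)
    finally have "DERIV E z :> (1 - 2 * c) * (y1 / c)\<^sup>2" .
    \<comment> \<open>Here c \<ge> 1 / 2 enters. Every c = n / 2 satisfies it, with equality for n =
      1, where y = cos (2 sqrt x) and the energy is constant.\<close>
    moreover have "(1 - 2 * c) * (y1 / c)\<^sup>2 \<le> 0"
      using assms by (intro mult_nonpos_nonneg) auto
    ultimately show ?thesis by blast
  qed
  then have "E x \<le> E 0"
    using DERIV_nonpos_imp_nonincreasing[of 0 x E] assms(2) by blast
  moreover have "(bessel_series c x)\<^sup>2 \<le> E x"
    using assms by (simp add: E_def)
  ultimately have "(bessel_series c x)\<^sup>2 \<le> 1"
    by (simp add: E_def)
  then show ?thesis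
    by (simp add: abs_square_le_1)
qed

section \<open>The hypergeometric factor of the multiplier\<close>

text \<open>
  \<open>hyp_series a c x\<close> is \<open>2F3(1, a; 2, c + 1, a + 1; -x)\<close>, rewritten with
  \<open>pochhammer a n / pochhammer (a + 1) n = a / (a + n)\<close>; the case distinction in the
  coefficients covers \<open>a = n = 0\<close>, where this quotient is \<open>1\<close> but \<open>a / (a + n) = 0 / 0 = 0\<close>.
  The analogous series without the factor \<open>a / (a + n)\<close> is \<open>1F2(1; 2, c + 1; -x)\<close>.
\<close>

definition base_coeff :: "real \<Rightarrow> nat \<Rightarrow> real" where
  "base_coeff c n = (-1) ^ n / (fact (Suc n) * pochhammer (c + 1) n)"

definition base_series :: "real \<Rightarrow> real \<Rightarrow> real" where
  "base_series c x = (\<Sum>n. base_coeff c n * x ^ n)"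

definition hyp_coeff :: "real \<Rightarrow> real \<Rightarrow> nat \<Rightarrow> real" where
  "hyp_coeff a c n = (if n = 0 then 1 else a / (a + real n)) * base_coeff c n"

definition hyp_series :: "real \<Rightarrow> real \<Rightarrow> real \<Rightarrow> real" where
  "hyp_series a c x = (\<Sum>n. hyp_coeff a c n * x ^ n)"

lemma abs_base_coeff_le:
  assumes "c > 0"
  shows "\<bar>base_coeff c n\<bar> \<le> 1 / fact n"
proof -
  have p: "pochhammer (c + 1) n \<ge> 1"
    using assms by (intro pochhammer_ge_1) auto
  have "fact n * 1 \<le> fact (Suc n) * pochhammer (c + 1) n"
    using p by (intro mult_mono fact_mono) auto
  then show ?thesis
    using p by (auto simp: base_coeff_def abs_mult power_abs intro!: divide_left_mono simp del: fact_Suc)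
qed

text \<open>For n \<ge> 1 the denominator a + n stays above 1 / 2, so every coefficient but the
  constant one vanishes linearly in a.\<close>

lemma abs_hyp_coeff_le:
  assumes "c > 0" "\<bar>a\<bar> \<le> 1 / 2" "n > 0"
  shows "\<bar>hyp_coeff a c n\<bar> \<le> 2 * \<bar>a\<bar> / fact n"
proof -
  have "a + real n \<ge> 1 / 2"
    using assms by auto
  then have "\<bar>a / (a + real n)\<bar> \<le> \<bar>a\<bar> / (1 / 2)"
    unfolding abs_divide by (intro divide_left_mono) auto
  then have "\<bar>a / (a + real n)\<bar> * \<bar>base_coeff c n\<bar> \<le> (2 * \<bar>a\<bar>) * (1 / fact n)"
    using assms by (intro mult_mono abs_base_coeff_le) auto
  then show ?thesis
    using assms by (simp add: hyp_coeff_def abs_mult)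
qed

lemma summable_base:
  assumes "c > 0"
  shows "summable (\<lambda>n. base_coeff c n * x ^ n)"
  using abs_base_coeff_le[OF assms] by (rule summable_powser_fact_bound)

lemma summable_hyp:
  assumes "c > 0" "\<bar>a\<bar> \<le> 1 / 2"
  shows "summable (\<lambda>n. hyp_coeff a c n * x ^ n)"
proof (rule summable_powser_fact_bound)
  fix n
  show "\<bar>hyp_coeff a c n\<bar> \<le> 1 / fact n"
  proof (cases "n = 0")
    case False
    then have "\<bar>hyp_coeff a c n\<bar> \<le> 2 * \<bar>a\<bar> / fact n"
      using assms by (intro abs_hyp_coeff_le) auto
    also have "\<dots> \<le> 1 / fact n"
      using assms by (intro divide_right_mono) auto
    finally show ?thesis .
  qed (simp add: hyp_coeff_def base_coeff_def)
qed

lemma hyp_series_0 [simp]: "hyp_series a c 0 = 1"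
  unfolding hyp_series_def powser_zero by (simp add: hyp_coeff_def base_coeff_def)

text \<open>The quotient (1)_n / (2)_n = 1 / (n + 1) makes 1F2 an antiderivative divided by x, so it
  reduces to 0F1 by an index shift and inherits its bounds.\<close>

lemma base_series_eq_bessel:
  assumes "c > 0"
  shows "x * base_series c x = c * (1 - bessel_series c x)"
proof -
  have "bessel_coeff c (Suc n) = - (1 / c) * base_coeff c n" for n
    using assms by (simp add: bessel_coeff_def base_coeff_def pochhammer_rec)
  then have "(\<Sum>n. bessel_coeff c (Suc n) * x ^ n) = - (1 / c) * base_series c x"
    unfolding base_series_def using assms
    by (subst suminf_mult[symmetric]) (auto intro!: summable_base)
  then have "bessel_series c x = 1 - (1 / c) * base_series c x * x"
    using powser_split_head(1)[OF summable_bessel[OF assms, of x]]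
    by (simp add: bessel_series_def bessel_coeff_def)
  then show ?thesis
    using assms by (simp add: field_simps)
qed

lemma base_series_bounds:
  assumes "c \<ge> 1 / 2" "x > 0"
  shows "0 \<le> base_series c x" "base_series c x \<le> 1"
proof -
  have c: "c > 0" using assms by simp
  have "0 \<le> c * (1 - bessel_series c x)"
    using c abs_bessel_series_le_1[of c x] assms by auto
  then have "0 \<le> x * base_series c x"
    by (simp only: base_series_eq_bessel[OF c])
  then show "0 \<le> base_series c x"
    using assms by (simp add: zero_le_mult_iff)
  \<comment> \<open>The derivative of z G(z), with G = \<open>base_series c\<close>, is 0F1(; c + 1;
    -z), which is at most 1; hence x G(x) - x decreases from 0.\<close>
  have "\<exists>d. DERIV (\<lambda>z. c * (1 - bessel_series c z) - z) z :> d \<and> d \<le> 0" if "z \<ge> 0" for z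
  proof (intro exI conjI)
    show "DERIV (\<lambda>z. c * (1 - bessel_series c z) - z) z :> bessel_series (c + 1) z - 1"
      using c by (auto intro!: derivative_eq_intros DERIV_bessel_series)
    show "bessel_series (c + 1) z - 1 \<le> 0"
      using abs_bessel_series_le_1[of "c + 1" z] c that by auto
  qed
  then have "c * (1 - bessel_series c x) - x \<le> c * (1 - bessel_series c 0) - 0"
    using assms by (intro DERIV_nonpos_imp_nonincreasing[of 0 x]) auto
  then have "x * base_series c x \<le> x * 1"
    by (simp add: base_series_eq_bessel[OF c])
  then show "base_series c x \<le> 1"
    using assms by simp
qed

text \<open>Beyond the constant term 1 the exponential series is a majorant. The estimate is not
  uniform in x: it serves for the limit at a fixed frequency and for x \<le> 1.\<close>

lemma abs_hyp_series_minus_1_le: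
  assumes "c > 0" "\<bar>a\<bar> \<le> 1 / 2" "x \<ge> 0"
  shows "\<bar>hyp_series a c x - 1\<bar> \<le> 2 * \<bar>a\<bar> * exp x"
proof -
  define d where "d n = hyp_coeff a c n * x ^ n - (if n = 0 then 1 else 0)" for n
  have "(\<lambda>n. hyp_coeff a c n * x ^ n) sums hyp_series a c x"
    unfolding hyp_series_def using summable_hyp assms by (intro summable_sums) auto
  from sums_diff[OF this sums_If_finite[of "\<lambda>n. n = 0" "\<lambda>_. 1"]]
  have d: "d sums (hyp_series a c x - 1)"
    by (simp add: d_def[abs_def])
  have e: "(\<lambda>n. 2 * \<bar>a\<bar> * (x ^ n /\<^sub>R fact n)) sums (2 * \<bar>a\<bar> * exp x)"
    by (intro sums_mult exp_converges)
  have "norm (d n) \<le> 2 * \<bar>a\<bar> * (x ^ n /\<^sub>R fact n)" for n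
  proof (cases "n = 0")
    case False
    have "\<bar>hyp_coeff a c n\<bar> * x ^ n \<le> (2 * \<bar>a\<bar> / fact n) * x ^ n"
      using False assms by (intro mult_right_mono abs_hyp_coeff_le) auto
    then show ?thesis
      using False assms by (simp add: d_def abs_mult field_simps)
  qed (simp add: d_def hyp_coeff_def base_coeff_def)
  from norm_suminf_le[OF this sums_summable[OF e]] show ?thesis
    using d e by (simp add: sums_iff)
qed

text \<open>The operator x d/dx + a multiplies the n-th coefficient by a + n, which cancels the
  denominator in \<open>hyp_coeff\<close>. The product x D is used so that x = 0 needs no
  division.\<close>

lemma DERIV_hyp_series:
  assumes "c > 0" "\<bar>a\<bar> \<le> 1 / 2"
  obtains D where "DERIV (hyp_series a c) x :> D"
    and "x * D = a * (base_series c x - hyp_series a c x)"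
proof
  note sh = summable_hyp[OF assms]
  note sb = summable_base[OF assms(1)]
  let ?D = "\<Sum>n. diffs (hyp_coeff a c) n * x ^ n"
  show "DERIV (hyp_series a c) x :> ?D"
    unfolding hyp_series_def[abs_def] by (intro termdiffs_strong_converges_everywhere sh)
  have sd: "summable (\<lambda>n. diffs (hyp_coeff a c) n * x ^ n)"
    by (rule termdiff_converges_all) (rule sh)
  have sh': "summable (\<lambda>n. hyp_coeff a c (Suc n) * x ^ n)"
    and sb': "summable (\<lambda>n. base_coeff c (Suc n) * x ^ n)"
    using powser_split_head(3)[OF sh] powser_split_head(3)[OF sb] by auto
  have "diffs (hyp_coeff a c) n = a * (base_coeff c (Suc n) - hyp_coeff a c (Suc n))" for n
  proof -
    have "a + real (Suc n) \<noteq> 0"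
      using assms by auto
    then have "(a + real (Suc n)) * hyp_coeff a c (Suc n) = a * base_coeff c (Suc n)"
      by (simp add: hyp_coeff_def del: of_nat_Suc)
    then show ?thesis
      by (simp add: diffs_def algebra_simps)
  qed
  then have "?D = (\<Sum>n. a * (base_coeff c (Suc n) * x ^ n - hyp_coeff a c (Suc n) * x ^ n))"
    by (simp only: mult.assoc left_diff_distrib)
  also have "\<dots> = a * ((\<Sum>n. base_coeff c (Suc n) * x ^ n) - (\<Sum>n. hyp_coeff a c (Suc n) * x ^ n))"
    by (simp add: suminf_mult[OF summable_diff[OF sb' sh']] suminf_diff[OF sb' sh'])
  finally have D_eq: "?D = a * ((\<Sum>n. base_coeff c (Suc n) * x ^ n) -
      (\<Sum>n. hyp_coeff a c (Suc n) * x ^ n))" .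
  have "x * ?D = a * ((\<Sum>n. base_coeff c (Suc n) * x ^ n) * x -
      (\<Sum>n. hyp_coeff a c (Suc n) * x ^ n) * x)"
    unfolding D_eq by (simp add: algebra_simps)
  \<comment> \<open>The two constant terms are both 1 and cancel in the difference.\<close>
  also have "\<dots> = a * (base_series c x - hyp_series a c x)"
    unfolding powser_split_head(2)[OF sh] powser_split_head(2)[OF sb]
    by (simp add: base_series_def hyp_series_def hyp_coeff_def base_coeff_def)
  finally show "x * ?D = a * (base_series c x - hyp_series a c x)" .
qed

text \<open>x^a is the integrating factor of x F' + a F = a G, an equation unchanged when b is
  subtracted from both F and G. The value b = 1 serves a \<le> 0, and b = 0 serves a > 0.\<close>

lemma DERIV_powr_mult_hyp_series:
  assumes "c > 0" "\<bar>a\<bar> \<le> 1 / 2" "x > 0"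
  shows "DERIV (\<lambda>x. x powr a * (hyp_series a c x - b)) x :>
    a * x powr (a - 1) * (base_series c x - b)"
proof -
  obtain D where D: "DERIV (hyp_series a c) x :> D"
    "x * D = a * (base_series c x - hyp_series a c x)"
    using DERIV_hyp_series[OF assms(1,2)] .
  have "x powr a * D = x powr (a - 1) * (x * D)"
    using assms by (simp add: powr_diff)
  also have "\<dots> = a * x powr (a - 1) * (base_series c x - hyp_series a c x)"
    unfolding D(2) by simp
  finally have *: "x powr a * D = a * x powr (a - 1) * (base_series c x - hyp_series a c x)" .
  have "DERIV (\<lambda>x. x powr a * (hyp_series a c x - b)) x :>
      a * x powr (a - 1) * (hyp_series a c x - b) + x powr a * D"
    using assms by (auto intro!: derivative_eq_intros D(1) simp: algebra_simps)
  then show ?thesis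
    unfolding * by (simp add: algebra_simps)
qed

text \<open>For a \<le> 0 and G \<le> 1 the function x^a (F - 1) is nondecreasing on x > 0, and it
  tends to 0 at 0 because F - 1 = O(x) and a > -1.\<close>

lemma hyp_series_ge_1:
  assumes "c \<ge> 1 / 2" "- (1 / 2) \<le> a" "a \<le> 0" "x > 0"
  shows "hyp_series a c x \<ge> 1"
proof -
  have a: "\<bar>a\<bar> \<le> 1 / 2" and c: "c > 0" using assms by auto
  define w where "w z = z powr a * (hyp_series a c z - 1)" for z
  have incr: "w e \<le> w x" if "0 < e" "e \<le> x" for e
  proof (rule DERIV_nonneg_imp_nondecreasing[OF that(2)])
    fix z assume "e \<le> z"
    then have z: "z > 0" using that by simp
    have "a * z powr (a - 1) * (base_series c z - 1) \<ge> 0"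
      using base_series_bounds[OF assms(1) z] assms(3)
      by (intro mult_nonpos_nonpos) (auto intro!: mult_nonpos_nonneg)
    then show "\<exists>d. DERIV w z :> d \<and> d \<ge> 0"
      unfolding w_def using DERIV_powr_mult_hyp_series[OF c a z] by blast
  qed
  \<comment> \<open>The factor e^a may blow up at 0, so \<open>w e\<close> is regrouped as e^(a + 1)
    times a difference quotient; the first factor tends to 0 and the second converges.\<close>
  obtain D where D: "DERIV (hyp_series a c) 0 :> D"
    using DERIV_hyp_series[OF c a] by blast
  have "((\<lambda>e. (hyp_series a c e - 1) / e) \<longlongrightarrow> D) (at_right 0)"
    using D unfolding has_field_derivative_iff
    by (simp add: filterlim_at_split)
  moreover have "((\<lambda>e. e powr (a + 1)) \<longlongrightarrow> 0 powr (a + 1)) (at_right 0)"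
    using assms by (intro tendsto_powr') (auto simp: eventually_at_right_less eventually_at_filter)
  ultimately have "((\<lambda>e. e powr (a + 1) * ((hyp_series a c e - 1) / e)) \<longlongrightarrow> 0 powr (a + 1) * D)
      (at_right 0)"
    by (intro tendsto_mult)
  moreover have "\<forall>\<^sub>F e in at_right 0. e powr (a + 1) * ((hyp_series a c e - 1) / e) \<le> w x"
    unfolding eventually_at_right_field
  proof (intro exI[of _ x] conjI allI impI assms(4))
    fix e :: real
    assume "0 < e" "e < x"
    then show "e powr (a + 1) * ((hyp_series a c e - 1) / e) \<le> w x"
      using incr[of e] by (simp add: w_def powr_add)
  qed
  ultimately have "0 \<le> w x"
    by (auto dest!: tendsto_upperbound)
  then show ?thesis
    using assms by (simp add: w_def zero_le_mult_iff)
qed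

text \<open>The exponent 1 / 2 replaces the varying a by one fixed rate; after multiplication by the
  squared norm of the frequency, linear growth is left.\<close>

lemma hyp_series_lower_bound:
  assumes "c \<ge> 1 / 2" "\<bar>a\<bar> \<le> 1 / 10" "x \<ge> 0"
  shows "hyp_series a c x \<ge> 2 / 5 * (1 + x) powr (- (1 / 2))"
proof -
  have a: "\<bar>a\<bar> \<le> 1 / 2" and c: "c > 0" using assms by auto
  have small: "hyp_series a c z \<ge> 2 / 5" if "0 \<le> z" "z \<le> 1" for z
  proof -
    have "exp z \<le> 3"
      using that exp_le by (meson exp_le_cancel_iff order_trans)
    \<comment> \<open>The deviation from 1 is at most 2 * (1 / 10) * 3 = 3 / 5, which yields the
      constant 2 / 5.\<close>
    then have "2 * \<bar>a\<bar> * exp z \<le> 2 * (1 / 10) * 3"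
      using assms by (intro mult_mono) auto
    then show ?thesis
      using abs_hyp_series_minus_1_le[OF c a that(1)] by auto
  qed
  have le1: "(1 + x) powr (- (1 / 2)) \<le> 1"
    using powr_mono[of "- (1 / 2)" 0 "1 + x"] assms by auto
  show ?thesis
  proof (cases "x \<le> 1")
    case True
    then show ?thesis
      using small[of x] le1 assms by auto
  next
    case False
    show ?thesis
    proof (cases "a \<le> 0")
      case True
      then show ?thesis
        using hyp_series_ge_1[of c a x] le1 assms False by auto
    next
      case apos: False
      define w where "w z = z powr a * (hyp_series a c z - 0)" for z
      have "w 1 \<le> w x"
      proof (rule DERIV_nonneg_imp_nondecreasing[where f = w])
        fix z :: real assume "1 \<le> z"
        then have z: "z > 0" by simp
        have "a * z powr (a - 1) * (base_series c z - 0) \<ge> 0"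
          using base_series_bounds[OF assms(1) z] apos by auto
        then show "\<exists>d. DERIV w z :> d \<and> d \<ge> 0"
          unfolding w_def using DERIV_powr_mult_hyp_series[OF c a z] by blast
      qed (use False in auto)
      then have "2 / 5 \<le> x powr a * hyp_series a c x"
        using small[of 1] by (simp add: w_def)
      then have "2 / 5 * x powr (- a) \<le> hyp_series a c x"
        using False by (simp add: powr_minus field_simps)
      moreover have "(1 + x) powr (- (1 / 2)) \<le> x powr (- (1 / 2))"
        using False by (intro powr_mono2') auto
      moreover have "x powr (- (1 / 2)) \<le> x powr (- a)"
        using False assms by (intro powr_mono) auto
      ultimately show ?thesis by linarith
    qed
  qed
qed

section \<open>The multiplier\<close>

text \<open>The hypothesis means that abs a < 1 for a = (n + 2 - \<beta>) / 2, so
  \<open>pochhammer (a + 1) j\<close> is positive and the quotient of Pochhammer symbols telescopes,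
  also at a = 0. The symbol (1)_j cancels j!, and (2)_j = (j + 1)!.\<close>

lemma nonlocal_multiplier_eq_hyp_series:
  fixes \<nu> :: "real ^ ('n::finite)"
  assumes "\<bar>real CARD('n) + 2 - \<beta>\<bar> < 2"
  shows "nonlocal_multiplier \<delta> \<beta> \<nu> = - (norm \<nu>)\<^sup>2 *
    hyp_series ((real CARD('n) + 2 - \<beta>) / 2) (real CARD('n) / 2) ((norm \<nu>)\<^sup>2 * \<delta>\<^sup>2 / 4)"
proof -
  define a c x where "a = (real CARD('n) + 2 - \<beta>) / 2" "c = real CARD('n) / 2"
    "x = (norm \<nu>)\<^sup>2 * \<delta>\<^sup>2 / 4"
  note acx = a_c_x_def
  have a: "\<bar>a\<bar> < 1" using assms by (simp add: acx)
  have term_eq: "pochhammer 1 j * pochhammer a j /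
      (pochhammer 2 j * pochhammer (c + 1) j * pochhammer (a + 1) j * fact j) * (- x) ^ j =
      hyp_coeff a c j * x ^ j" for j
  proof -
    have p2: "pochhammer 2 j = (fact (Suc j) :: real)"
      using pochhammer_rec[of "1 :: real" j] by (simp add: pochhammer_fact)
    have p1: "pochhammer 1 j = (fact j :: real)"
      by (simp add: pochhammer_fact)
    have pa: "pochhammer (a + 1) j > 0"
      using a by (intro pochhammer_pos) auto
    define R where "R = (if j = 0 then 1 else a / (a + real j))"
    have "pochhammer a j = pochhammer (a + 1) j * R"
    proof (cases "j = 0")
      case False
      then have "a + real j > 0" using a by auto
      then show ?thesis
        using pochhammer_rec[of a j] pochhammer_Suc[of a j] False by (simp add: R_def field_simps)
    qed (simp add: R_def)
    moreover have "(- x) ^ j = (-1) ^ j * x ^ j"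
      by (rule power_minus)
    ultimately show ?thesis
      unfolding p1 p2 hyp_coeff_def base_coeff_def R_def[symmetric]
      using pa by (simp del: fact_Suc)
  qed
  have "(real CARD('n) + 2) / 2 = c + 1" "(real CARD('n) + 4 - \<beta>) / 2 = a + 1"
    "- (1 / 4) * (norm \<nu>)\<^sup>2 * \<delta>\<^sup>2 = - x"
    by (auto simp: acx field_simps)
  then show ?thesis
    unfolding nonlocal_multiplier_series by (simp only: acx(1)[symmetric] term_eq)
      (simp add: hyp_series_def acx)
qed

lemma nonlocal_multiplier_critical_limit:
  fixes \<nu> :: "real ^ ('n::finite)"
  shows "((\<lambda>\<beta>. nonlocal_multiplier \<delta> \<beta> \<nu>) \<longlongrightarrow> - (norm \<nu>)\<^sup>2) (at (real CARD('n) + 2))"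
proof -
  define a where "a \<beta> = (real CARD('n) + 2 - \<beta>) / 2" for \<beta>
  define c where "c = real CARD('n) / 2"
  define x where "x = (norm \<nu>)\<^sup>2 * \<delta>\<^sup>2 / 4"
  have c: "c > 0" and x: "x \<ge> 0"
    by (simp_all add: c_def x_def)
  have near: "\<forall>\<^sub>F \<beta> in at (real CARD('n) + 2). \<bar>a \<beta>\<bar> \<le> 1 / 2"
    unfolding eventually_at by (intro exI[of _ 1]) (auto simp: a_def dist_real_def)
  have "((\<lambda>\<beta>. 2 * \<bar>a \<beta>\<bar> * exp x) \<longlongrightarrow> 2 * \<bar>a (real CARD('n) + 2)\<bar> * exp x) (at (real CARD('n) + 2))"
    unfolding a_def by (intro tendsto_intros) auto
  then have "((\<lambda>\<beta>. 2 * \<bar>a \<beta>\<bar> * exp x) \<longlongrightarrow> 0) (at (real CARD('n) + 2))"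
    by (simp add: a_def)
  moreover have "\<forall>\<^sub>F \<beta> in at (real CARD('n) + 2). norm (hyp_series (a \<beta>) c x - 1) \<le> 2 * \<bar>a \<beta>\<bar> * exp x"
    using near by eventually_elim (use abs_hyp_series_minus_1_le[OF c _ x] in simp)
  ultimately have "((\<lambda>\<beta>. hyp_series (a \<beta>) c x - 1) \<longlongrightarrow> 0) (at (real CARD('n) + 2))"
    by (rule Lim_null_comparison[rotated])
  then have "((\<lambda>\<beta>. - (norm \<nu>)\<^sup>2 * hyp_series (a \<beta>) c x) \<longlongrightarrow> - (norm \<nu>)\<^sup>2 * 1) (at (real CARD('n) + 2))"
    by (intro tendsto_mult tendsto_const) (simp add: LIM_zero_iff)
  moreover have "\<forall>\<^sub>F \<beta> in at (real CARD('n) + 2).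
      - (norm \<nu>)\<^sup>2 * hyp_series (a \<beta>) c x = nonlocal_multiplier \<delta> \<beta> \<nu>"
    using near
    by eventually_elim (simp add: nonlocal_multiplier_eq_hyp_series a_def c_def x_def)
  ultimately show ?thesis
    using Lim_transform_eventually by fastforce
qed

text \<open>The radius 1 / 5 for \<beta> gives abs a \<le> 1 / 10. Linear decay, uniform in \<beta>,
  already lets the exponential beat every polynomial weight; the shift by 1 covers low
  frequencies.\<close>

lemma nonlocal_multiplier_upper_bound:
  fixes \<nu> :: "real ^ ('n::finite)"
  assumes "\<delta> > 0" "\<bar>real CARD('n) + 2 - \<beta>\<bar> \<le> 1 / 5"
  shows "nonlocal_multiplier \<delta> \<beta> \<nu> \<le> - (2 / (5 + 5 * \<delta>)) * (norm \<nu> - 1)"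
proof -
  define N where "N = norm \<nu>"
  define x where "x = N\<^sup>2 * \<delta>\<^sup>2 / 4"
  define h where "h = hyp_series ((real CARD('n) + 2 - \<beta>) / 2) (real CARD('n) / 2) x"
  have N: "N \<ge> 0" and x: "x \<ge> 0" by (auto simp: N_def x_def)
  have "1 + x \<le> (1 + N * \<delta>)\<^sup>2"
    using N assms by (simp add: x_def power2_eq_square algebra_simps)
  moreover have "(1 + x) powr (1 / 2) = sqrt (1 + x)"
    using x by (simp add: powr_half_sqrt)
  ultimately have "(1 + x) powr (1 / 2) \<le> 1 + N * \<delta>"
    using N assms real_le_lsqrt[of "1 + N * \<delta>" "1 + x"] by simp
  then have "inverse (1 + N * \<delta>) \<le> inverse ((1 + x) powr (1 / 2))"
    using x by (intro le_imp_inverse_le) auto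
  then have "2 / 5 * inverse (1 + N * \<delta>) \<le> 2 / 5 * (1 + x) powr (- (1 / 2))"
    by (simp add: powr_minus)
  also have "\<dots> \<le> h"
    unfolding h_def using assms x by (intro hyp_series_lower_bound) auto
  finally have "N\<^sup>2 * (2 / 5 * inverse (1 + N * \<delta>)) \<le> N\<^sup>2 * h"
    by (intro mult_left_mono) auto
  moreover have "2 / (5 + 5 * \<delta>) * (N - 1) \<le> N\<^sup>2 * (2 / 5 * inverse (1 + N * \<delta>))"
  proof -
    \<comment> \<open>Cross-multiplying the desired inequality and completing the square shows a
      positive difference.\<close>
    have "N\<^sup>2 * (1 + \<delta>) - (N - 1) * (1 + N * \<delta>) = (N - 1 / 2)\<^sup>2 + 3 / 4 + N * \<delta>"
      by (simp add: power2_eq_square algebra_simps)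
    also have "\<dots> \<ge> 0" using N assms by simp
    finally have "(N - 1) * (1 + N * \<delta>) \<le> N\<^sup>2 * (1 + \<delta>)" by simp
    moreover have "1 + N * \<delta> > 0" "1 + \<delta> > 0"
      using N assms by (auto intro!: add_pos_nonneg)
    ultimately have "(N - 1) / (1 + \<delta>) \<le> N\<^sup>2 / (1 + N * \<delta>)"
      by (simp add: divide_le_eq pos_le_divide_eq mult.commute)
    then have "2 / 5 * ((N - 1) / (1 + \<delta>)) \<le> 2 / 5 * (N\<^sup>2 / (1 + N * \<delta>))"
      by (intro mult_left_mono) auto
    moreover have "5 + 5 * \<delta> = 5 * (1 + \<delta>)" by simp
    ultimately show ?thesis
      by (simp only: divide_inverse inverse_mult_distrib mult_ac)
  qed
  moreover have "nonlocal_multiplier \<delta> \<beta> \<nu> = - (N\<^sup>2 * h)"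
    using assms by (simp add: nonlocal_multiplier_eq_hyp_series h_def x_def N_def)
  ultimately show ?thesis
    unfolding N_def[symmetric] by linarith
qed

section \<open>Convergence in Sobolev spaces\<close>

text \<open>The Weierstrass M-test makes the finite partial sums converge uniformly over all
  parameters obeying the bound, which permits exchanging the two limits.\<close>

lemma tendsto_infsum_dominated:
  fixes g :: "'b \<Rightarrow> 'a \<Rightarrow> 'c :: banach"
  assumes "\<And>k. k \<in> A \<Longrightarrow> ((\<lambda>x. g x k) \<longlongrightarrow> h k) F"
    and "\<forall>\<^sub>F x in F. \<forall>k\<in>A. norm (g x k) \<le> w k"
    and "h summable_on A" "w summable_on A"
  shows "((\<lambda>x. \<Sum>\<^sub>\<infinity>k\<in>A. g x k) \<longlongrightarrow> (\<Sum>\<^sub>\<infinity>k\<in>A. h k)) F"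
proof (rule swap_uniform_limit')
  show "\<forall>\<^sub>F X in finite_subsets_at_top A. ((\<lambda>x. \<Sum>k\<in>X. g x k) \<longlongrightarrow> (\<Sum>k\<in>X. h k)) F"
    by (rule eventually_finite_subsets_at_top_weakI) (auto intro!: tendsto_sum assms(1))
  show "((\<lambda>X. \<Sum>k\<in>X. h k) \<longlongrightarrow> (\<Sum>\<^sub>\<infinity>k\<in>A. h k)) (finite_subsets_at_top A)"
    using assms(3) by (rule infsum_tendsto)
  show "uniform_limit {x. \<forall>k\<in>A. norm (g x k) \<le> w k}
      (\<lambda>X x. \<Sum>k\<in>X. g x k) (\<lambda>x. \<Sum>\<^sub>\<infinity>k\<in>A. g x k) (finite_subsets_at_top A)"
    by (rule Weierstrass_m_test_general[OF _ assms(4)]) auto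
qed (use assms(2) in auto)

lemma powr_times_exp_bounded:
  fixes p \<mu> :: real
  assumes "\<mu> > 0"
  shows "\<exists>M. \<forall>y\<ge>0. (1 + y\<^sup>2) powr p * exp (- \<mu> * y) \<le> M"
proof (intro exI allI impI)
  \<comment> \<open>\<open>ln v \<le> v - 1\<close> at v = \<eta> (1 + y) bounds the logarithm by a
    line of slope \<eta>, chosen so that 2 abs p \<eta> \<le> \<mu>. The summand 1 in the
    denominator covers p = 0.\<close>
  define \<eta> where "\<eta> = \<mu> / (2 * \<bar>p\<bar> + 1)"
  have \<eta>: "\<eta> > 0" "2 * \<bar>p\<bar> * \<eta> \<le> \<mu>"
    using assms by (auto simp: \<eta>_def field_simps)
  fix y :: real assume y: "y \<ge> 0"
  have "ln (\<eta> * (1 + y)) \<le> \<eta> * (1 + y) - 1"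
    using \<eta> y by (intro ln_le_minus_one) auto
  then have l: "ln (1 + y) \<le> \<eta> * y + (\<eta> - ln \<eta>)"
    using \<eta> y ln_mult_pos[of \<eta> "1 + y"] by (simp add: distrib_left)
  have "p * ln (1 + y\<^sup>2) \<le> \<bar>p\<bar> * ln (1 + y\<^sup>2)"
    by (intro mult_right_mono) auto
  also have "\<dots> \<le> \<bar>p\<bar> * ln ((1 + y)\<^sup>2)"
    using y by (intro mult_left_mono, subst ln_le_cancel_iff) (auto simp: power2_eq_square algebra_simps intro!: add_pos_nonneg)
  also have "ln ((1 + y)\<^sup>2) = 2 * ln (1 + y)"
    using y by (simp add: ln_realpow)
  also have "\<bar>p\<bar> * (2 * ln (1 + y)) \<le> \<bar>p\<bar> * (2 * (\<eta> * y + (\<eta> - ln \<eta>)))"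
    using l by (intro mult_left_mono) auto
  also have "\<dots> = (2 * \<bar>p\<bar> * \<eta>) * y + 2 * \<bar>p\<bar> * (\<eta> - ln \<eta>)"
    by (simp add: algebra_simps)
  also have "\<dots> \<le> \<mu> * y + 2 * \<bar>p\<bar> * (\<eta> - ln \<eta>)"
    using mult_right_mono[OF \<eta>(2) y] by simp
  finally have "p * ln (1 + y\<^sup>2) - \<mu> * y \<le> 2 * \<bar>p\<bar> * (\<eta> - ln \<eta>)" by simp
  moreover have "1 + y\<^sup>2 > 0" by (simp add: add_pos_nonneg)
  ultimately show "(1 + y\<^sup>2) powr p * exp (- \<mu> * y) \<le> exp (2 * \<bar>p\<bar> * (\<eta> - ln \<eta>))"
    by (simp add: powr_def flip: exp_add)
qed

lemma knorm_nonneg: "knorm k \<ge> 0"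
  by (simp add: knorm_def)

text \<open>The multiplier decays in the frequency while the Sobolev weight uses the index k; the
  smallest of the 2 pi / r_i compares them componentwise.\<close>

lemma norm_freq_ge:
  fixes r :: "real ^ ('n::finite)"
  assumes "\<And>i. r $ i > 0"
  obtains \<rho> where "\<rho> > 0" "\<And>k. \<rho> * knorm k \<le> norm (freq r k)"
proof
  define \<rho> where "\<rho> = Min (range (\<lambda>i. 2 * pi / r $ i))"
  show pos: "\<rho> > 0"
    unfolding \<rho>_def using assms by (subst Min_gr_iff) auto
  fix k :: "int ^ 'n"
  define z :: "real ^ 'n" where "z = (\<chi> i. real_of_int (k $ i))"
  have "norm (\<rho> *\<^sub>R z) \<le> norm (freq r k)"
  proof (rule norm_le_componentwise_cart)
    fix i
    have "\<rho> \<le> 2 * pi / r $ i"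
      unfolding \<rho>_def by (intro Min_le) auto
    then have "\<rho> * \<bar>z $ i\<bar> \<le> (2 * pi / r $ i) * \<bar>z $ i\<bar>"
      by (intro mult_right_mono) auto
    then show "norm ((\<rho> *\<^sub>R z) $ i) \<le> norm (freq r k $ i)"
      using pos assms[of i] by (simp add: z_def freq_def abs_mult abs_divide)
  qed
  then show "\<rho> * knorm k \<le> norm (freq r k)"
    using pos by (simp add: knorm_def z_def)
qed

text \<open>The weight of order q splits into those of orders s and q - s; the exponential absorbs
  the latter. As \<open>w\<close> does not depend on z, it serves both for membership and as a
  dominating family.\<close>

lemma sobolev_majorant:
  fixes f :: "('n::finite) pdist"
  assumes "f \<in> sobolev_space s" "\<kappa> > 0"
  obtains w where "w summable_on UNIV"
    "\<And>(k :: int ^ 'n) z. cmod z \<le> exp (C - \<kappa> * knorm k) \<Longrightarrow>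
       (1 + (knorm k)\<^sup>2) powr q * (cmod (f k * z))\<^sup>2 \<le> w k"
proof -
  \<comment> \<open>The rate is doubled because z enters squared.\<close>
  obtain M where M: "\<And>y. y \<ge> 0 \<Longrightarrow> (1 + y\<^sup>2) powr (q - s) * exp (- (2 * \<kappa>) * y) \<le> M"
    using powr_times_exp_bounded[of "2 * \<kappa>" "q - s"] assms(2) by auto
  define w where "w k = exp (2 * C) * M * ((1 + (knorm k)\<^sup>2) powr s * (cmod (f k))\<^sup>2)" for k :: "int ^ 'n"
  show ?thesis
  proof
    show "w summable_on UNIV"
      unfolding w_def using assms(1) by (intro summable_on_cmult_right) (simp add: sobolev_space_def)
    fix k :: "int ^ 'n" and z :: complex
    assume z: "cmod z \<le> exp (C - \<kappa> * knorm k)"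
    define W where "W = 1 + (knorm k)\<^sup>2"
    have W: "W powr q = W powr s * W powr (q - s)"
      by (simp flip: powr_add)
    have "(cmod z)\<^sup>2 \<le> (exp (C - \<kappa> * knorm k))\<^sup>2"
      using z by (intro power_mono) auto
    also have "\<dots> = exp (2 * C) * exp (- (2 * \<kappa>) * knorm k)"
      by (simp add: power2_eq_square flip: exp_add)
    finally have "W powr (q - s) * (cmod z)\<^sup>2 \<le>
        W powr (q - s) * (exp (2 * C) * exp (- (2 * \<kappa>) * knorm k))"
      by (intro mult_left_mono) auto
    also have "\<dots> = exp (2 * C) * (W powr (q - s) * exp (- (2 * \<kappa>) * knorm k))"
      by (simp only: mult_ac)
    also have "\<dots> \<le> exp (2 * C) * M"
      unfolding W_def by (intro mult_left_mono M knorm_nonneg) auto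
    finally have "(W powr s * (cmod (f k))\<^sup>2) * (W powr (q - s) * (cmod z)\<^sup>2) \<le>
        (W powr s * (cmod (f k))\<^sup>2) * (exp (2 * C) * M)"
      by (intro mult_left_mono) auto
    then show "(1 + (knorm k)\<^sup>2) powr q * (cmod (f k * z))\<^sup>2 \<le> w k"
      unfolding W_def[symmetric] w_def W by (simp add: norm_mult power_mult_distrib mult_ac)
  qed
qed

text \<open>Linear decay of the exponents smooths f into every order q, and one majorant valid
  eventually along F allows dominated convergence of the squared norm.\<close>

lemma tendsto_sobolev_inf_multiplier:
  fixes f :: "('n::finite) pdist" and \<mu> :: "'b \<Rightarrow> int ^ 'n \<Rightarrow> real"
  assumes f: "f \<in> sobolev_space s" and \<kappa>: "\<kappa> > 0"
    and lim: "\<And>k. ((\<lambda>x. \<mu> x k) \<longlongrightarrow> \<mu>0 k) F"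
    and bound: "\<forall>\<^sub>F x in F. \<forall>k. \<mu> x k \<le> C - \<kappa> * knorm k"
    and bound0: "\<And>k. \<mu>0 k \<le> C - \<kappa> * knorm k"
  shows "tendsto_sobolev_inf (\<lambda>x k. f k * exp (complex_of_real (\<mu> x k)))
    (\<lambda>k. f k * exp (complex_of_real (\<mu>0 k))) F"
proof -
  have mem: "(\<lambda>k. f k * exp (complex_of_real (m k))) \<in> sobolev_space q"
    if m: "\<And>k. m k \<le> C - \<kappa> * knorm k" for m :: "int ^ 'n \<Rightarrow> real" and q
  proof -
    obtain w where w: "w summable_on UNIV"
      "\<And>k z. cmod z \<le> exp (C - \<kappa> * knorm k) \<Longrightarrow>
         (1 + (knorm k)\<^sup>2) powr q * (cmod (f k * z))\<^sup>2 \<le> w k"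
      using sobolev_majorant[OF f \<kappa>] by blast
    show ?thesis
      unfolding sobolev_space_def mem_Collect_eq
      by (rule summable_on_comparison_test[OF w(1)]) (auto intro!: w(2) m)
  qed
  have "((\<lambda>x. sobolev_norm q (\<lambda>k. f k * exp (complex_of_real (\<mu> x k)) -
      f k * exp (complex_of_real (\<mu>0 k)))) \<longlongrightarrow> 0) F" for q
  proof -
    \<comment> \<open>The summand ln 2 accounts for the difference of two exponentials, each at most
      exp (C - \<kappa> * knorm k).\<close>
    obtain w where w: "w summable_on UNIV"
      "\<And>k z. cmod z \<le> exp (C + ln 2 - \<kappa> * knorm k) \<Longrightarrow>
         (1 + (knorm k)\<^sup>2) powr q * (cmod (f k * z))\<^sup>2 \<le> w k"
      using sobolev_majorant[OF f \<kappa>] by blast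
    define g where "g x k = (1 + (knorm k)\<^sup>2) powr q *
      (cmod (f k * (exp (complex_of_real (\<mu> x k)) - exp (complex_of_real (\<mu>0 k)))))\<^sup>2" for x k
    have "((\<lambda>x. infsum (g x) UNIV) \<longlongrightarrow> infsum (\<lambda>_. 0) (UNIV :: (int ^ 'n) set)) F"
    proof (rule tendsto_infsum_dominated)
      fix k
      have "((\<lambda>x. g x k) \<longlongrightarrow> (1 + (knorm k)\<^sup>2) powr q *
          (cmod (f k * (exp (complex_of_real (\<mu>0 k)) - exp (complex_of_real (\<mu>0 k)))))\<^sup>2) F"
        unfolding g_def by (intro tendsto_intros lim)
      then show "((\<lambda>x. g x k) \<longlongrightarrow> 0) F" by simp
    next
      show "\<forall>\<^sub>F x in F. \<forall>k\<in>UNIV. norm (g x k) \<le> w k"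
        using bound
      proof eventually_elim
        case (elim x)
        show ?case
        proof
          fix k
          have "cmod (exp (complex_of_real (\<mu> x k)) - exp (complex_of_real (\<mu>0 k))) \<le>
              exp (\<mu> x k) + exp (\<mu>0 k)"
            by (rule order_trans[OF norm_triangle_ineq4]) simp
          also have "\<dots> \<le> exp (C - \<kappa> * knorm k) + exp (C - \<kappa> * knorm k)"
            using elim bound0 by (intro add_mono) auto
          also have "\<dots> = exp (C + ln 2 - \<kappa> * knorm k)"
            by (simp add: exp_add exp_diff)
          finally show "norm (g x k) \<le> w k"
            using w(2) by (simp add: g_def)
        qed
      qed
    qed (use w(1) in auto)
    then have "((\<lambda>x. sqrt (infsum (g x) UNIV)) \<longlongrightarrow> sqrt 0) F"
      by (intro tendsto_real_sqrt) simp
    then show ?thesis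
      by (simp add: sobolev_norm_def g_def[abs_def] right_diff_distrib)
  qed
  moreover have "\<forall>\<^sub>F x in F. \<forall>q. (\<lambda>k. f k * exp (complex_of_real (\<mu> x k))) \<in> sobolev_space q"
    using bound by eventually_elim (auto intro!: mem)
  ultimately show ?thesis
    using mem[OF bound0]
    by (auto simp: tendsto_sobolev_inf_def tendsto_sobolev_def sobolev_inf_def elim: eventually_mono)
qed

text \<open>Needed because the nonlocal solutions are identified with explicit multipliers only for
  \<beta> close to n + 2.\<close>

lemma tendsto_sobolev_inf_transform:
  assumes lim: "tendsto_sobolev_inf g h F" and eq: "\<forall>\<^sub>F x in F. g x = g' x"
  shows "tendsto_sobolev_inf g' h F"
proof -
  have "\<forall>\<^sub>F x in F. g' x \<in> A" if "\<forall>\<^sub>F x in F. g x \<in> A" for A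
    using that eq by eventually_elim simp
  moreover have "((\<lambda>x. sobolev_norm q (\<lambda>k. g' x k - h k)) \<longlongrightarrow> 0) F"
    if "((\<lambda>x. sobolev_norm q (\<lambda>k. g x k - h k)) \<longlongrightarrow> 0) F" for q
    using that by (rule Lim_transform_eventually) (use eq in eventually_elim, simp)
  ultimately show ?thesis
    using lim by (simp add: tendsto_sobolev_inf_def tendsto_sobolev_def)
qed

section \<open>Both evolutions as Fourier multipliers, and the passage to the limit\<close>

theorem theorem8:
  fixes r :: "real ^ ('n::finite)" and \<delta> s t :: real
    and f :: "'n pdist"
    and u :: "real \<Rightarrow> 'n pdist"
    and v :: "real \<Rightarrow> real \<Rightarrow> 'n pdist"
  assumes "\<And>i. r $ i > 0"
    and "\<delta> > 0"
    and "f \<in> sobolev_space s"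
    and "evolution_solution (laplacian r) f u"
    and "\<And>\<beta>. \<beta> < real CARD('n) + 4 \<Longrightarrow> evolution_solution (nonlocal_op r \<delta> \<beta>) f (v \<beta>)"
    and "t > 0"
  shows "tendsto_sobolev_inf (\<lambda>\<beta>. v \<beta> t) (u t) (at (real CARD('n) + 2))"
proof -
  let ?n = "real CARD('n)"
  define \<eta> where "\<eta> = 2 / (5 + 5 * \<delta>) * t"
  have \<eta>: "\<eta> > 0" using assms by (simp add: \<eta>_def)
  obtain \<rho> where \<rho>: "\<rho> > 0" "\<And>k :: int ^ 'n. \<rho> * knorm k \<le> norm (freq r k)"
    using norm_freq_ge assms(1) by blast
  define \<mu> where "\<mu> \<beta> k = nonlocal_multiplier \<delta> \<beta> (freq r k) * t" for \<beta> k
  \<comment> \<open>The ball contains its centre, so the bound also holds for the limiting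
    exponent.\<close>
  define near where "near \<beta> \<longleftrightarrow> \<bar>?n + 2 - \<beta>\<bar> \<le> 1 / 5" for \<beta>
  have ev: "\<forall>\<^sub>F \<beta> in at (?n + 2). near \<beta>"
    unfolding eventually_at near_def by (intro exI[of _ "1 / 5"]) (auto simp: dist_real_def abs_minus_commute)
  have bound: "\<mu> \<beta> k \<le> \<eta> - (\<eta> * \<rho>) * knorm k" if "near \<beta>" for \<beta> k
  proof -
    have "\<mu> \<beta> k \<le> - (2 / (5 + 5 * \<delta>)) * (norm (freq r k) - 1) * t"
      unfolding \<mu>_def using assms that
      by (intro mult_right_mono nonlocal_multiplier_upper_bound) (auto simp: near_def)
    also have "\<dots> = \<eta> - \<eta> * norm (freq r k)"
      by (simp only: \<eta>_def) (simp only: algebra_simps mult_1_right)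
    also have "\<dots> \<le> \<eta> - \<eta> * (\<rho> * knorm k)"
      using \<rho>(2)[of k] \<eta> by simp
    finally show ?thesis by (simp add: mult.assoc)
  qed
  have "tendsto_sobolev_inf (\<lambda>\<beta> k. f k * exp (complex_of_real (\<mu> \<beta> k)))
      (\<lambda>k. f k * exp (complex_of_real (\<mu> (?n + 2) k))) (at (?n + 2))"
  proof (rule tendsto_sobolev_inf_multiplier[OF assms(3)])
    show "\<eta> * \<rho> > 0" using \<eta> \<rho> by simp
    show "((\<lambda>\<beta>. \<mu> \<beta> k) \<longlongrightarrow> \<mu> (?n + 2) k) (at (?n + 2))" for k
      unfolding \<mu>_def nonlocal_multiplier_critical
      by (intro tendsto_mult tendsto_const nonlocal_multiplier_critical_limit)
    show "\<forall>\<^sub>F \<beta> in at (?n + 2). \<forall>k. \<mu> \<beta> k \<le> \<eta> - \<eta> * \<rho> * knorm k"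
      using ev by eventually_elim (use bound in blast)
    show "\<mu> (?n + 2) k \<le> \<eta> - \<eta> * \<rho> * knorm k" for k
      by (rule bound) (simp add: near_def)
  qed
  \<comment> \<open>At \<beta> = n + 2 the multiplier is that of the Laplacian, and uniqueness of
    the coefficientwise solution identifies \<open>u t\<close>.\<close>
  also have "(\<lambda>k. f k * exp (complex_of_real (\<mu> (?n + 2) k))) = u t"
    using evolution_solution_multiplier(2)[OF laplacian_eq assms(4), of t] assms(6)
    by (auto simp: \<mu>_def nonlocal_multiplier_critical)
  finally have lim: "tendsto_sobolev_inf (\<lambda>\<beta> k. f k * exp (complex_of_real (\<mu> \<beta> k))) (u t) (at (?n + 2))" .
  have v: "(\<lambda>k. f k * exp (complex_of_real (\<mu> \<beta> k))) = v \<beta> t" if "near \<beta>" for \<beta>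
  proof -
    have "\<beta> < ?n + 4"
      using that by (simp add: near_def abs_if split: if_splits)
    from evolution_solution_multiplier(2)[OF _ assms(5)[OF this], of "\<lambda>k. nonlocal_multiplier \<delta> \<beta> (freq r k)" t]
    show ?thesis
      using assms(6) by (auto simp: \<mu>_def nonlocal_op_def)
  qed
  have "\<forall>\<^sub>F \<beta> in at (?n + 2). (\<lambda>k. f k * exp (complex_of_real (\<mu> \<beta> k))) = v \<beta> t"
    using ev by eventually_elim (rule v)
  with lim show ?thesis
    by (rule tendsto_sobolev_inf_transform)
qed

end
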